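(* Let $U$, $\Lambda$, $U_S$, $\|\cdot\|_S$, $u^*\in U_S$, the nodes $x_1,\ldots,x_M$, the test functionals $\lambda_1,\ldots,\lambda_N\in\Lambda$, the matrix $\mathbf{A}=(a_j(\lambda_k))_{1\le k\le N,\,1\le j\le M}\in\mathbb{R}^{N\times M}$ of rank $M\le N$, the data vector $\mathbf{f}=(\lambda_1(u^* ),\ldots,\lambda_N(u^* ))^T$, the exponents $1\le p,q\le\infty$, the stability constant $C_S(\mathbf{A})$ and the consistency vector $\mathbf{c}=(c(\lambda_1),\ldots,c(\lambda_N))^T$ be as in the context, and assume $\|u^*\|_S>0$. Let $\mathbf{u}^*=(u^*(x_1),\ldots,u^*(x_M))^T$ be the vector of exact nodal values, and let $\tilde{\mathbf{u}}\in\mathbb{R}^M$ be any vector satisfying $$\|\mathbf{A}\tilde{\mathbf{u}}-\mathbf{f}\|_q\le K(\mathbf{A})\,\|\mathbf{A}\mathbf{u}^*-\mathbf{f}\|_q$$ for some constant $K(\mathbf{A})\ge 0$. Then $$\frac{\|\mathbf{u}^*-\tilde{\mathbf{u}}\|_p}{\|u^*\|_S}\le (1+K(\mathbf{A}))\,C_S(\mathbf{A})\,\|\mathbf{c}\|_q .$$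
   Context: Setting. $U$ is a normed linear space of real-valued functions on a set $\Omega\subset\mathbb{R}^d$ such that every point evaluation $\delta_x:u\mapsto u(x)$, $x\in\Omega$, belongs to the topological dual $U^*$. $\Lambda\subset U^*$ is a fixed set of continuous linear functionals. The problem is to find $u\in U$ with $\lambda(u)=f_\lambda$ for all $\lambda\in\Lambda$, where the data are $f_\lambda=\lambda(u^* )$ for some $u^*\in U$ (the true solution). Discretization. Nodes $x_1,\ldots,x_M\in\Omega$ are fixed, and each $\lambda\in\Lambda$ is approximated by a functional $\tilde\lambda(u):=\sum_{j=1}^M a_j(\lambda)u(x_j)$ with given real coefficients $a_j(\lambda)$. A finite selection $\lambda_1,\ldots,\lambda_N\in\Lambda$ of test functionals is fixed such that the matrix $\mathbf{A}=(a_j(\lambda_k))_{1\le k\le N,1\le j\le M}$ has rank $M\le N$. Stability constant. For the fixed $1\le p,q\le\infty$, $\|\cdot\|_p$ and $\|\cdot\|_q$ are the discrete $\ell_p$ norm on $\mathbb{R}^M$ and the discrete $\ell_q$ norm on $\mathbb{R}^N$, and $$C_S(\mathbf{A}):=\sup_{\mathbf{u}\in\mathbb{R}^M,\ \mathbf{u}\ne 0}\frac{\|\mathbf{u}\|_p}{\|\mathbf{A}\mathbf{u}\|_q}<\infty .$$ Consistency. $U_S\subset U$ is a linear subspace carrying a norm or seminorm $\|\cdot\|_S$, the true solution $u^*$ lies in $U_S$, and for each $\lambda\in\Lambda$ there is a constant $c(\lambda)\ge 0$ with $$|\lambda(u)-\tilde\lambda(u)|\le c(\lambda)\|u\|_S\quad\text{for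 all }u\in U_S .$$ (If $\|\cdot\|_S$ is only a seminorm, $\tilde\lambda$ is assumed to coincide with $\lambda$ on its null space.) *)

theory Defs
  imports "HOL-Analysis.Analysis"
begin

text \<open>
  A normed linear space of real-valued functions on \<open>\<Omega>\<close> is represented by a type \<open>'u\<close> of class
  \<^class>\<open>real_normed_vector\<close> with a map \<open>val\<close> sending \<open>u\<close> to the function \<open>val u\<close>. The vector space
  operations of \<open>'u\<close> are the pointwise ones on \<open>\<Omega>\<close>, and elements of \<open>'u\<close> with the same values on
  \<open>\<Omega>\<close> are equal. Values of \<open>val u\<close> outside \<open>\<Omega>\<close> carry no meaning. The topological dual is the
  type \<open>'u \<Rightarrow>\<^sub>L real\<close>.
\<close>

definition normed_function_space ::
    "(real^'d) set \<Rightarrow> ('u::real_normed_vector \<Rightarrow> real^'d \<Rightarrow> real) \<Rightarrow> bool" where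
  "normed_function_space \<Omega> val \<longleftrightarrow>
     (\<forall>x\<in>\<Omega>. \<forall>u v. val (u + v) x = val u x + val v x) \<and>
     (\<forall>x\<in>\<Omega>. \<forall>r u. val (r *\<^sub>R u) x = r * val u x) \<and>
     (\<forall>u v. (\<forall>x\<in>\<Omega>. val u x = val v x) \<longrightarrow> u = v)"

definition seminorm_on :: "'u::real_vector set \<Rightarrow> ('u \<Rightarrow> real) \<Rightarrow> bool" where
  "seminorm_on S n \<longleftrightarrow>
     (\<forall>u\<in>S. 0 \<le> n u) \<and>
     (\<forall>u\<in>S. \<forall>r. n (r *\<^sub>R u) = \<bar>r\<bar> * n u) \<and>
     (\<forall>u\<in>S. \<forall>v\<in>S. n (u + v) \<le> n u + n v)"

definition discrete_functional ::
    "('u \<Rightarrow> 'x \<Rightarrow> real) \<Rightarrow> ('m::finite \<Rightarrow> 'x) \<Rightarrow> ('m \<Rightarrow> real) \<Rightarrow> 'u \<Rightarrow> real" where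
  "discrete_functional val x w u = (\<Sum>j\<in>UNIV. w j * val u (x j))"

text \<open>The exponent ranges over \<open>[1, \<infinity>]\<close>. Since \<open>0 powr r = 0\<close>, zero entries contribute nothing.\<close>

definition lp_norm :: "ereal \<Rightarrow> real^'n \<Rightarrow> real" where
  "lp_norm p v =
     (if p = \<infinity> then Max (range (\<lambda>i. \<bar>v $ i\<bar>))
      else (\<Sum>i\<in>UNIV. \<bar>v $ i\<bar> powr real_of_ereal p) powr (1 / real_of_ereal p))"

text \<open>
  The quotient is taken in \<^typ>\<open>ereal\<close>, where a positive number divided by \<open>0\<close> is \<open>\<infinity>\<close>. Hence the
  constant is \<open>\<infinity>\<close> if \<open>A\<close> has a nontrivial kernel; it is finite if \<open>A\<close> has full column rank,
  see \<open>stability_const_finite\<close> below.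
\<close>

definition stability_const :: "ereal \<Rightarrow> ereal \<Rightarrow> real^'m^'n \<Rightarrow> ereal" where
  "stability_const p q A = (SUP u\<in>{u. u \<noteq> 0}. ereal (lp_norm p u) / ereal (lp_norm q (A *v u)))"

lemma lp_norm_nonneg: "0 \<le> lp_norm p v"
proof (cases "p = \<infinity>")
  case True
  have "\<bar>v $ undefined\<bar> \<le> Max (range (\<lambda>i. \<bar>v $ i\<bar>))" by (rule Max_ge) auto
  then show ?thesis using True unfolding lp_norm_def by (smt (verit))
qed (simp add: lp_norm_def)

lemma component_le_lp_norm:
  assumes "1 \<le> p" shows "\<bar>v $ i\<bar> \<le> lp_norm p v"
proof (cases "p = \<infinity>")
  case True
  then show ?thesis unfolding lp_norm_def by (auto intro: Max_ge)
next
  case False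
  then obtain r where r: "p = ereal r" "1 \<le> r" using assms by (cases p) auto
  have "\<bar>v $ i\<bar> powr r \<le> (\<Sum>i\<in>UNIV. \<bar>v $ i\<bar> powr r)" by (rule member_le_sum) auto
  then have "(\<bar>v $ i\<bar> powr r) powr (1 / r) \<le> (\<Sum>i\<in>UNIV. \<bar>v $ i\<bar> powr r) powr (1 / r)"
    using r by (intro powr_mono2) auto
  then show ?thesis using r by (simp add: lp_norm_def powr_powr)
qed

lemma lp_norm_le_norm:
  fixes v :: "real^'n"
  assumes "1 \<le> p" shows "lp_norm p v \<le> real CARD('n) * norm v"
proof (cases "p = \<infinity>")
  case True
  have "Max (range (\<lambda>i. \<bar>v $ i\<bar>)) \<le> norm v" by (simp add: component_le_norm_cart)
  also have "\<dots> \<le> real CARD('n) * norm v"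
    using mult_right_mono[of 1 "real CARD('n)" "norm v"] by simp
  finally show ?thesis using True by (simp add: lp_norm_def)
next
  case False
  then obtain r where r: "p = ereal r" "1 \<le> r" using assms by (cases p) auto
  have "(\<Sum>i\<in>UNIV. \<bar>v $ i\<bar> powr r) \<le> (\<Sum>i\<in>(UNIV::'n set). norm v powr r)"
    using r by (intro sum_mono powr_mono2) (auto simp: component_le_norm_cart)
  then have "(\<Sum>i\<in>UNIV. \<bar>v $ i\<bar> powr r) powr (1 / r) \<le> (real CARD('n) * norm v powr r) powr (1 / r)"
    using r by (intro powr_mono2) (auto simp: sum_nonneg)
  also have "\<dots> = real CARD('n) powr (1 / r) * norm v" using r by (simp add: powr_mult powr_powr)
  also have "\<dots> \<le> real CARD('n) powr 1 * norm v"
    using r by (intro mult_right_mono powr_mono) (auto simp: Suc_leI)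
  finally show ?thesis using r by (simp add: lp_norm_def)
qed

lemma norm_le_lp_norm:
  fixes v :: "real^'n"
  assumes "1 \<le> p" shows "norm v \<le> real CARD('n) * lp_norm p v"
proof -
  have "norm v \<le> (\<Sum>i\<in>UNIV. \<bar>v $ i\<bar>)" by (rule norm_le_l1_cart)
  also have "\<dots> \<le> (\<Sum>i\<in>(UNIV::'n set). lp_norm p v)"
    by (intro sum_mono component_le_lp_norm assms)
  finally show ?thesis by simp
qed

lemma stability_const_finite:
  fixes A :: "real^'m^'n"
  assumes "1 \<le> p" "1 \<le> q" and rank: "rank A = CARD('m)"
  shows "stability_const p q A < \<infinity>"
proof -
  have "inj ((*v) A)" using rank full_rank_injective by blast
  then obtain B where B: "B > 0" "\<And>u. norm (A *v u) \<ge> B * norm u"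
    using linear_inj_bounded_below_pos[OF matrix_vector_mul_linear[of A]] by auto
  define C where "C = real CARD('m) * real CARD('n) / B"
  have "stability_const p q A \<le> ereal C"
    unfolding stability_const_def
  proof (rule SUP_least)
    fix u :: "real^'m" assume "u \<in> {u. u \<noteq> 0}"
    then have "0 < B * norm u" using B by simp
    also have le: "\<dots> \<le> real CARD('n) * lp_norm q (A *v u)"
      using B(2) norm_le_lp_norm[OF assms(2)] order_trans by blast
    finally have pos: "0 < lp_norm q (A *v u)" by (simp add: zero_less_mult_iff)
    have "lp_norm p u \<le> real CARD('m) * norm u" by (rule lp_norm_le_norm[OF assms(1)])
    also have "\<dots> \<le> real CARD('m) * (real CARD('n) * lp_norm q (A *v u) / B)"
      using le B by (intro mult_left_mono) (auto simp: field_simps)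
    finally have "lp_norm p u / lp_norm q (A *v u) \<le> C"
      using pos B by (simp add: C_def field_simps)
    then show "ereal (lp_norm p u) / ereal (lp_norm q (A *v u)) \<le> ereal C"
      using pos by simp
  qed
  also have "\<dots> < \<infinity>" by simp
  finally show ?thesis .
qed

end

theory Submission
  imports Defs
begin

text \<open>
  The error \<open>u\<^sup>* - u\<close> is controlled by its image under \<open>A\<close>, which splits at the data \<open>f\<close> into the
  residual of the exact nodal values and the residual of the computed vector. The second is at most
  \<open>K\<close> times the first, and the entries of the first are consistency errors.
\<close>

lemma lp_norm_minus: "lp_norm p (- v) = lp_norm p v"
  by (simp add: lp_norm_def)

lemma lp_norm_scaleR:
  assumes "1 \<le> p" shows "lp_norm p (s *\<^sub>R v) = \<bar>s\<bar> * lp_norm p v"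
proof (cases "p = \<infinity>")
  case True
  have "mono ((*) \<bar>s\<bar>)" by (rule monoI) (simp add: mult_left_mono)
  then have "\<bar>s\<bar> * Max (range (\<lambda>i. \<bar>v $ i\<bar>)) = Max ((*) \<bar>s\<bar> ` range (\<lambda>i. \<bar>v $ i\<bar>))"
    by (rule mono_Max_commute) auto
  then show ?thesis using True by (simp add: lp_norm_def image_image abs_mult)
next
  case False
  then obtain r where r: "p = ereal r" "1 \<le> r" using assms by (cases p) auto
  then show ?thesis
    by (simp add: lp_norm_def abs_mult powr_mult powr_powr sum_nonneg flip: sum_distrib_left)
qed

lemma lp_norm_eq_0_iff:
  assumes "1 \<le> p" shows "lp_norm p v = 0 \<longleftrightarrow> v = 0"
proof
  assume "lp_norm p v = 0"
  then show "v = 0" using norm_le_lp_norm[OF assms, of v] by simp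
next
  assume "v = 0"
  then show "lp_norm p v = 0" using lp_norm_scaleR[OF assms, of 0 v] by simp
qed

text \<open>Both the maximum and the sum of powers depend monotonically on the absolute values of
  the entries. This turns entrywise consistency estimates into an estimate of the residual
  norm.\<close>

lemma lp_norm_mono:
  assumes "1 \<le> p" and le: "\<And>i. \<bar>v $ i\<bar> \<le> \<bar>w $ i\<bar>"
  shows "lp_norm p v \<le> lp_norm p w"
proof (cases "p = \<infinity>")
  case True
  have "\<bar>v $ i\<bar> \<le> Max (range (\<lambda>i. \<bar>w $ i\<bar>))" for i
    by (rule order_trans[OF le[of i]]) (auto intro: Max_ge)
  then show ?thesis using True by (simp add: lp_norm_def)
next
  case False
  then obtain r where r: "p = ereal r" "1 \<le> r" using assms(1) by (cases p) auto
  then show ?thesis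
    by (auto simp: lp_norm_def intro!: powr_mono2 sum_mono sum_nonneg le)
qed

text \<open>Undoing the outer root allows the triangle inequality to be proved on the level of
  \<open>r\<close>-th powers.\<close>

lemma sum_powr_eq_lp_norm:
  assumes "1 \<le> r"
  shows "(\<Sum>i\<in>UNIV. \<bar>v $ i\<bar> powr r) = lp_norm (ereal r) v powr r"
  using assms by (simp add: lp_norm_def powr_powr sum_nonneg)

text \<open>Entries of a vector may vanish, so convexity is wanted on the closed half-line. For two
  positive points it is \<open>powr_convex\<close>; if one point is 0, its term vanishes and only
  the bound \<open>contract\<close> for the other remains.\<close>

lemma convex_powr_ge_0:
  fixes r :: real
  assumes "1 \<le> r" shows "convex_on {0..} (\<lambda>t. t powr r)"
proof (rule convex_onI)
  fix t x y :: real
  assume t: "0 < t" "t < 1" and xy: "x \<in> {0..}" "y \<in> {0..}"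
  \<comment> \<open>This reduces to \<open>k powr r \<le> k\<close>: for a base in (0,1), raising
    the exponent from 1 to \<open>r\<close> does not increase the power.\<close>
  have contract: "(k * z) powr r \<le> k * z powr r" if "0 < k" "k < 1" "0 \<le> z" for k z :: real
    using that assms powr_mono'[of 1 r k] by (simp add: powr_mult mult_right_mono)
  consider "x = 0" | "y = 0" | "0 < x" "0 < y" using xy by force
  then show "((1 - t) *\<^sub>R x + t *\<^sub>R y) powr r \<le> (1 - t) * x powr r + t * y powr r"
  proof cases
    case 1
    then show ?thesis using contract[of t y] t xy by simp
  next
    case 2
    then show ?thesis using contract[of "1 - t" x] t xy by simp
  next
    case 3
    then show ?thesis using convex_onD[OF powr_convex[OF assms], of t x y] t by simp
  qed
qed simp

text \<open>
  Convexity of \<open>t powr r\<close> is applied to each entry of the convex combination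
  of \<open>v / \<parallel>v\<parallel>\<close> and \<open>w / \<parallel>w\<parallel>\<close> with weights proportional to \<open>\<parallel>v\<parallel>\<close> and \<open>\<parallel>w\<parallel>\<close>.
\<close>

lemma lp_norm_triangle:
  assumes "1 \<le> p" shows "lp_norm p (v + w) \<le> lp_norm p v + lp_norm p w"
proof (cases "p = \<infinity>")
  case True
  have "\<bar>(v + w) $ i\<bar> \<le> lp_norm p v + lp_norm p w" for i
    using component_le_lp_norm[OF assms, of v i] component_le_lp_norm[OF assms, of w i] by simp
  then show ?thesis using True by (subst lp_norm_def) simp
next
  case False
  then obtain r where r: "p = ereal r" "1 \<le> r" using assms by (cases p) auto
  show ?thesis
  \<comment> \<open>A zero vector cannot be normalized; in that case the sum is just the other
    vector.\<close>
  proof (cases "v = 0 \<or> w = 0")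
    case True
    then show ?thesis using lp_norm_nonneg[of p v] lp_norm_nonneg[of p w] by auto
  next
    case False
    define s t where "s = lp_norm p v" and "t = lp_norm p w"
    have st: "0 < s" "0 < t"
      using False by (simp_all add: s_def t_def less_le lp_norm_nonneg lp_norm_eq_0_iff[OF assms])
    have "\<bar>(v + w) $ i\<bar> powr r \<le> (s + t) powr r *
        (s / (s + t) * (\<bar>v $ i\<bar> powr r / s powr r) + t / (s + t) * (\<bar>w $ i\<bar> powr r / t powr r))" for i
    proof -
      \<comment> \<open>All factors on the right cancel, leaving the sum of the two absolute
        values.\<close>
      have "\<bar>(v + w) $ i\<bar> \<le> (s + t) * (s / (s + t) * (\<bar>v $ i\<bar> / s) + t / (s + t) * (\<bar>w $ i\<bar> / t))"
        using st by (simp add: add_nonneg_eq_0_iff flip: add_divide_distrib)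
      then have "\<bar>(v + w) $ i\<bar> powr r \<le>
          ((s + t) * (s / (s + t) * (\<bar>v $ i\<bar> / s) + t / (s + t) * (\<bar>w $ i\<bar> / t))) powr r"
        using r by (intro powr_mono2) auto
      also have "\<dots> = (s + t) powr r *
          (s / (s + t) * (\<bar>v $ i\<bar> / s) + t / (s + t) * (\<bar>w $ i\<bar> / t)) powr r"
        by (rule powr_mult)
      also have "\<dots> \<le> (s + t) powr r *
          (s / (s + t) * (\<bar>v $ i\<bar> / s) powr r + t / (s + t) * (\<bar>w $ i\<bar> / t) powr r)"
        using convex_onD[OF convex_powr_ge_0[OF r(2)], of "t / (s + t)" "\<bar>v $ i\<bar> / s" "\<bar>w $ i\<bar> / t"] st
        by (intro mult_left_mono) (auto simp: field_simps)
      finally show ?thesis using st by (simp add: powr_divide)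
    qed
    then have "(\<Sum>i\<in>UNIV. \<bar>(v + w) $ i\<bar> powr r) \<le> (\<Sum>i\<in>UNIV. (s + t) powr r *
        (s / (s + t) * (\<bar>v $ i\<bar> powr r / s powr r) + t / (s + t) * (\<bar>w $ i\<bar> powr r / t powr r)))"
      by (rule sum_mono)
    also have "\<dots> = (s + t) powr r * (s / (s + t) * ((\<Sum>i\<in>UNIV. \<bar>v $ i\<bar> powr r) / s powr r)
        + t / (s + t) * ((\<Sum>i\<in>UNIV. \<bar>w $ i\<bar> powr r) / t powr r))"
      by (simp add: sum.distrib sum_distrib_left sum_divide_distrib distrib_left)
    \<comment> \<open>Each normalized sum of powers equals 1, and the two weights add up to
      1.\<close>
    also have "\<dots> = (s + t) powr r"
      using st r unfolding sum_powr_eq_lp_norm[OF r(2)] s_def t_def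
      by (simp flip: add_divide_distrib)
    finally have "lp_norm p (v + w) powr r \<le> (s + t) powr r"
      unfolding sum_powr_eq_lp_norm[OF r(2)] by (simp add: r)
    \<comment> \<open>The \<open>r\<close>-th power is removed by contradiction: strict monotonicity
      would carry a strict excess over \<open>s + t\<close> to the powers.\<close>
    then show ?thesis
      using r(2) st powr_less_mono2[of r "s + t" "lp_norm p (v + w)"]
      by (force simp: s_def t_def not_less[symmetric])
  qed
qed

text \<open>The supremum of the empty set would be \<open>-\<infinity>\<close>, so a nonzero vector
  is needed; the all-ones vector serves. Its quotient is nonnegative even for denominator 0, whose
  inverse is \<open>\<infinity>\<close> in \<open>ereal\<close>.\<close>

lemma stability_const_nonneg:
  fixes A :: "real^'m^'n"
  shows "0 \<le> stability_const p q A"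
proof -
  have "(1 :: real^'m) \<noteq> 0" by simp
  then have "ereal (lp_norm p (1 :: real^'m)) / ereal (lp_norm q (A *v 1)) \<le> stability_const p q A"
    unfolding stability_const_def by (intro SUP_upper CollectI)
  moreover have "0 \<le> ereal (lp_norm p (1 :: real^'m)) / ereal (lp_norm q (A *v 1))"
    by (simp add: divide_ereal_def lp_norm_nonneg)
  ultimately show ?thesis by (rule order_trans[rotated])
qed

text \<open>Full column rank makes the denominator positive for \<open>u \<noteq> 0\<close>, so the
  bound on the quotient can be multiplied out. The zero vector, left out of the supremum, makes both
  sides 0.\<close>

lemma lp_norm_le_stability_const:
  fixes A :: "real^'m^'n"
  assumes "1 \<le> p" "1 \<le> q" and rank: "rank A = CARD('m)"
  shows "ereal (lp_norm p u) \<le> stability_const p q A * ereal (lp_norm q (A *v u))"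
proof (cases "u = 0")
  case True
  then show ?thesis
    using lp_norm_eq_0_iff[OF assms(1), of u] lp_norm_eq_0_iff[OF assms(2), of "A *v u"]
    by (simp flip: zero_ereal_def)
next
  case False
  have "inj ((*v) A)" using rank full_rank_injective by blast
  then have "A *v u \<noteq> 0" using False by (metis injD matrix_vector_mult_0_right)
  then have pos: "0 < lp_norm q (A *v u)"
    by (simp add: less_le lp_norm_nonneg lp_norm_eq_0_iff[OF assms(2)])
  have "ereal (lp_norm p u) / ereal (lp_norm q (A *v u)) \<le> stability_const p q A"
    unfolding stability_const_def using False by (intro SUP_upper) simp
  then show ?thesis
    using pos by (subst mult.commute) (rule iffD1[OF ereal_divide_le_pos]; simp)
qed

theorem theorem1:
  fixes \<Omega> :: "(real^'d) set"
    and val :: "'u::real_normed_vector \<Rightarrow> real^'d \<Rightarrow> real"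
    and \<Lambda> :: "('u \<Rightarrow>\<^sub>L real) set"
    and x :: "'m::finite \<Rightarrow> real^'d"
    and a :: "('u \<Rightarrow>\<^sub>L real) \<Rightarrow> 'm \<Rightarrow> real"
    and test :: "'n::finite \<Rightarrow> ('u \<Rightarrow>\<^sub>L real)"
    and A :: "real^'m^'n"
    and p q :: ereal
    and U\<^sub>S :: "'u set"
    and norm\<^sub>S :: "'u \<Rightarrow> real"
    and c :: "('u \<Rightarrow>\<^sub>L real) \<Rightarrow> real"
    and u\<^sub>0 :: 'u
    and f c_vec :: "real^'n"
    and u_nodal u_approx :: "real^'m"
    and K :: real
  assumes function_space: "normed_function_space \<Omega> val"
    and point_evaluation: "\<And>y. y \<in> \<Omega> \<Longrightarrow> bounded_linear (\<lambda>u. val u y)"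
    and nodes: "\<And>j. x j \<in> \<Omega>"
    and test_functionals: "\<And>k. test k \<in> \<Lambda>"
    and A_eq: "A = (\<chi> k j. a (test k) j)"
    and rank_A: "rank A = CARD('m)"
    and M_le_N: "CARD('m) \<le> CARD('n)"
    and exponents: "1 \<le> p" "1 \<le> q"
    and subspace_U\<^sub>S: "subspace U\<^sub>S"
    and seminorm_S: "seminorm_on U\<^sub>S norm\<^sub>S"
    and null_space: "\<And>l u. l \<in> \<Lambda> \<Longrightarrow> u \<in> U\<^sub>S \<Longrightarrow> norm\<^sub>S u = 0 \<Longrightarrow>
          discrete_functional val x (a l) u = blinfun_apply l u"
    and c_nonneg: "\<And>l. l \<in> \<Lambda> \<Longrightarrow> 0 \<le> c l"
    and consistency: "\<And>l u. l \<in> \<Lambda> \<Longrightarrow> u \<in> U\<^sub>S \<Longrightarrow>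
          \<bar>blinfun_apply l u - discrete_functional val x (a l) u\<bar> \<le> c l * norm\<^sub>S u"
    and true_solution: "u\<^sub>0 \<in> U\<^sub>S" "0 < norm\<^sub>S u\<^sub>0"
    and f_eq: "f = (\<chi> k. blinfun_apply (test k) u\<^sub>0)"
    and c_vec_eq: "c_vec = (\<chi> k. c (test k))"
    and u_nodal_eq: "u_nodal = (\<chi> j. val u\<^sub>0 (x j))"
    and K_nonneg: "0 \<le> K"
    and near_optimal: "lp_norm q (A *v u_approx - f) \<le> K * lp_norm q (A *v u_nodal - f)"
  shows "ereal (lp_norm p (u_nodal - u_approx) / norm\<^sub>S u\<^sub>0)
           \<le> ereal (1 + K) * stability_const p q A * ereal (lp_norm q c_vec)"
proof -
  have residual: "lp_norm q (A *v u_nodal - f) \<le> norm\<^sub>S u\<^sub>0 * lp_norm q c_vec"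
  proof -
    \<comment> \<open>Entry \<open>k\<close> of the residual is, up to sign, the consistency error
      of \<open>test k\<close> at \<open>u\<^sub>0\<close>. Nonnegativity of \<open>c\<close> and
      \<open>norm\<^sub>S u\<^sub>0\<close> puts its bound into the absolute-value form that
      \<open>lp_norm_mono\<close> expects.\<close>
    have "lp_norm q (A *v u_nodal - f) \<le> lp_norm q (norm\<^sub>S u\<^sub>0 *\<^sub>R c_vec)"
    proof (rule lp_norm_mono[OF exponents(2)])
      fix k
      have "(A *v u_nodal) $ k = discrete_functional val x (a (test k)) u\<^sub>0"
        by (simp add: A_eq u_nodal_eq discrete_functional_def matrix_vector_mult_def)
      then show "\<bar>(A *v u_nodal - f) $ k\<bar> \<le> \<bar>(norm\<^sub>S u\<^sub>0 *\<^sub>R c_vec) $ k\<bar>"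
        using consistency[OF test_functionals true_solution(1), of k] c_nonneg[OF test_functionals, of k]
          true_solution(2)
        by (simp add: f_eq c_vec_eq abs_minus_commute abs_mult mult.commute)
    qed
    then show ?thesis using true_solution(2) by (simp add: lp_norm_scaleR[OF exponents(2)])
  qed
  have "A *v (u_nodal - u_approx) = (A *v u_nodal - f) + - (A *v u_approx - f)"
    by (simp add: matrix_vector_mult_diff_distrib)
  then have "lp_norm q (A *v (u_nodal - u_approx))
      \<le> lp_norm q (A *v u_nodal - f) + lp_norm q (A *v u_approx - f)"
    using lp_norm_triangle[OF exponents(2)] lp_norm_minus by metis
  also have "\<dots> \<le> (1 + K) * lp_norm q (A *v u_nodal - f)"
    using near_optimal by (simp add: algebra_simps)
  also have "\<dots> \<le> (1 + K) * (norm\<^sub>S u\<^sub>0 * lp_norm q c_vec)"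
    using residual K_nonneg by (intro mult_left_mono) auto
  finally have image: "lp_norm q (A *v (u_nodal - u_approx))
      \<le> (1 + K) * (norm\<^sub>S u\<^sub>0 * lp_norm q c_vec)" .
  \<comment> \<open>Being finite and nonnegative, the constant is a real number, so the rest is real
    arithmetic; its sign is what allows \<open>image\<close> to be multiplied by it.\<close>
  obtain C where C: "stability_const p q A = ereal C" "0 \<le> C"
    using stability_const_nonneg[of p q A] stability_const_finite[OF exponents rank_A]
    by (cases "stability_const p q A") auto
  have "lp_norm p (u_nodal - u_approx) \<le> C * lp_norm q (A *v (u_nodal - u_approx))"
    using lp_norm_le_stability_const[OF exponents rank_A, of "u_nodal - u_approx"] C by simp
  also have "\<dots> \<le> C * ((1 + K) * (norm\<^sub>S u\<^sub>0 * lp_norm q c_vec))"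
    using image C(2) by (rule mult_left_mono)
  \<comment> \<open>Dividing by the positive number \<open>norm\<^sub>S u\<^sub>0\<close> gives the
    relative error.\<close>
  finally show ?thesis using true_solution(2) C(1) by (simp add: field_simps)
qed

end
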